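(* Let $\Psi,h,\mathcal Z,R,\mu$ be as in the context (so that $f=\Psi+h$ satisfies the standing assumptions (A1)–(A4) and the weighted quadratic functional growth condition with parameter $\mu>0$). Let $r_0\in\mathbb R^{n_z}$ and $\epsilon>0$, and consider the algorithm "Gradient Based Restart FISTA" described in the context. Then: (i) The iterates $y_k$ started from $r_0$, not taking into account the restart procedure, satisfy $\|\mathcal G(y_k)\|_{R^{-1}}\le\dfrac{4(1+\sqrt{\mu+1})}{\mu k}\|\mathcal G(r_0)\|_{R^{-1}}$ for all $k\ge1$. (ii) The iterates $y_k$ started from $r_0$, not taking into account the restart procedure, satisfy $\|\mathcal G(y_k)\|_{R^{-1}}\le\frac1e\|\mathcal G(r_0)\|_{R^{-1}}$ for all $k\ge\frac{4e}{\mu}(1+\sqrt{\mu+1})$. (iii) Let $a(\mu)=\max\left\{1,\frac{4e(1+\sqrt{\mu+1})}{\mu}\right\}$. Then the iterates of the algorithm with restarts satisfy $$\min_{i=0,\dots,k}\left\{\|\mathcal G(y_i)\|_{R^{-1}},\ \|\mathcal G(r_0)\|_{R^{-1}}\right\}\le e\left(\frac1e\right)^{\left\lfloor \frac{k}{a(\mu)}\right\rfloor}\|\mathcal G(r_0)\|_{R^{-1}} .$$ (iv) The total number of iterations $k_{\rm out}$ required to exit the algorithm is upper bounded by $$k_{\rm out}\le\max\left\{1,\frac{4e(1+\sqrt{\mu+1})}{\mu}\right\}\left\lceil\log\left(\frac{\|\mathcal G(r_0)\|_{R^{-1}}}{\epsilon}\right)\right\rceil .$$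
   Context: For a symmetric positive definite matrix $M$, $\|x\|_M=\sqrt{x^\top M x}$. $e$ is Euler's number and $\log$ the natural logarithm. Problem: $f^*=\min_{z\in\mathcal Z}\{f(z)=\Psi(z)+h(z)\}$, where: (A1) $\Psi:\mathbb R^{n_z}\to\mathbb R\cup\{\pm\infty\}$ is a proper closed convex function, possibly non-smooth; (A2) $h:\mathbb R^{n_z}\to\mathbb R$ is differentiable and convex and $R$ is a symmetric positive definite matrix with $h(z)\le h(y)+\langle\nabla h(y),z-y\rangle+\frac12\|z-y\|_R^2$ for all $z,y\in\mathbb R^{n_z}$; (A3) $\mathcal Z\subseteq\mathbb R^{n_z}$ is non-empty, closed and convex; (A4) there is $z^*\in\mathcal Z\cap\mathrm{dom}(\Psi)$ with $f^*=f(z^* )=\inf_{z\in\mathcal Z}f(z)$. Optimal set: $\Omega_f=\{z\in\mathcal Z: f(z)=f^*\}$. $\pi^R_{\Omega_f}(z)=\arg\min_{v\in\Omega_f}\|v-z\|_R$. Weighted quadratic functional growth with parameter $\mu>0$: $f(z)-f^*\ge\frac{\mu}{2}\|z-\pi^R_{\Omega_f}(z)\|_R^2$ for all $z\in\mathcal Z$. Composite gradient mapping: $\mathcal T(y)=\arg\min_{z\in\mathcal Z}\Psi(z)+\langle\nabla h(y),z-y\rangle+\frac12\|z-y\|_R^2$ (a unique point) and $\mathcal G(y)=R(y-\mathcal T(y))$. Algorithm "Gradient Based Restart FISTA": given $r_0\in\mathbb R^{n_z}$ and $\epsilon>0$, set $y_0=z_0=\mathcal T(r_0)$, $t_0=1$,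 $k=0$, $j=0$, $\rho_0=\|\mathcal G(r_0)\|_{R^{-1}}$. Repeat: (1) $k\leftarrow k+1$; (2) $z_k\leftarrow\mathcal T(y_{k-1})$, $t_k\leftarrow\frac12\bigl(1+\sqrt{1+4t_{k-1}^2}\bigr)$; (3) $y_k\leftarrow z_k+\frac{t_{k-1}-1}{t_k}(z_k-z_{k-1})$; (4) (restart) if $\|\mathcal G(y_k)\|_{R^{-1}}\le\rho_j/e$, then $j\leftarrow j+1$, $r_j\leftarrow y_k$, $\rho_j\leftarrow\|\mathcal G(r_j)\|_{R^{-1}}$, and afterwards the values carried to the next iteration are reset to $y_k\leftarrow\mathcal T(r_j)$, $z_k\leftarrow\mathcal T(r_j)$, $t_k\leftarrow1$; until $\rho_j\le\epsilon$. The output $k_{\rm out}$ is the final value of $k$. "Not taking into account the restart procedure" means that only steps (1)–(3) are executed for all $k\ge 1$. In (iii), $k$ ranges over the iterations of the algorithm and $y_i$ denotes, for $i\ge1$, the vector computed in step (3) at iteration $i$ (before any reset), and $y_0=\mathcal T(r_0)$.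
   Formalization: The bound on k_out in (iv) is proved only when ‖G(r_0)‖_{R^{-1}} > ε; otherwise its right-hand side is ≤ 0 or undefined while the repeat-until loop always performs at least one iteration. Termination is proved in all cases. *)

theory Defs
  imports "HOL-Analysis.Analysis"
begin

text \<open>Extended-valued convex analysis. Closedness and convexity are those of the epigraph, a subset
  of \<open>E \<times> real\<close>.\<close>

definition epi :: "('a::euclidean_space \<Rightarrow> ereal) \<Rightarrow> ('a \<times> real) set" where
  "epi \<phi> = {(x, r). \<phi> x \<le> ereal r}"

definition proper_fun :: "('a::euclidean_space \<Rightarrow> ereal) \<Rightarrow> bool" where
  "proper_fun \<phi> \<longleftrightarrow> (\<forall>x. \<phi> x \<noteq> -\<infinity>) \<and> (\<exists>x. \<phi> x < \<infinity>)"

definition closed_fun :: "('a::euclidean_space \<Rightarrow> ereal) \<Rightarrow> bool" where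
  "closed_fun \<phi> \<longleftrightarrow> closed (epi \<phi>)"

definition convex_fun :: "('a::euclidean_space \<Rightarrow> ereal) \<Rightarrow> bool" where
  "convex_fun \<phi> \<longleftrightarrow> convex (epi \<phi>)"

definition edom :: "('a::euclidean_space \<Rightarrow> ereal) \<Rightarrow> 'a set" where
  "edom \<phi> = {x. \<phi> x < \<infinity>}"

definition sym_pos_def :: "real^'n^'n \<Rightarrow> bool" where
  "sym_pos_def M \<longleftrightarrow> transpose M = M \<and> (\<forall>x. x \<noteq> 0 \<longrightarrow> x \<bullet> (M *v x) > 0)"

definition wnorm :: "real^'n^'n \<Rightarrow> real^'n \<Rightarrow> real" where
  "wnorm M x = sqrt (x \<bullet> (M *v x))"

definition objective :: "(real^'n \<Rightarrow> ereal) \<Rightarrow> (real^'n \<Rightarrow> real) \<Rightarrow> real^'n \<Rightarrow> ereal" where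
  "objective \<Psi> h z = \<Psi> z + ereal (h z)"

definition opt_value :: "('a \<Rightarrow> ereal) \<Rightarrow> 'a set \<Rightarrow> ereal" where
  "opt_value f Z = (INF z\<in>Z. f z)"

definition opt_set :: "('a \<Rightarrow> ereal) \<Rightarrow> 'a set \<Rightarrow> 'a set" where
  "opt_set f Z = {z \<in> Z. f z = opt_value f Z}"

definition wproj :: "real^'n^'n \<Rightarrow> (real^'n) set \<Rightarrow> real^'n \<Rightarrow> real^'n" where
  "wproj R S z = arg_min_on (\<lambda>v. wnorm R (v - z)) S"

definition quadratic_growth ::
  "real \<Rightarrow> real^'n^'n \<Rightarrow> (real^'n \<Rightarrow> ereal) \<Rightarrow> (real^'n) set \<Rightarrow> bool" where
  "quadratic_growth \<mu> R f Z \<longleftrightarrow>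
     (\<forall>z\<in>Z. f z - opt_value f Z \<ge> ereal (\<mu> / 2 * (wnorm R (z - wproj R (opt_set f Z) z))\<^sup>2))"

text \<open>In the following, \<open>dh\<close> is the gradient of the smooth part \<open>h\<close>.\<close>

definition comp_step ::
  "(real^'n \<Rightarrow> ereal) \<Rightarrow> (real^'n \<Rightarrow> real^'n) \<Rightarrow> (real^'n) set \<Rightarrow> real^'n^'n \<Rightarrow> real^'n \<Rightarrow> real^'n" where
  "comp_step \<Psi> dh Z R y =
     arg_min_on (\<lambda>z. \<Psi> z + ereal (dh y \<bullet> (z - y) + 1 / 2 * (wnorm R (z - y))\<^sup>2)) Z"

definition comp_grad ::
  "(real^'n \<Rightarrow> ereal) \<Rightarrow> (real^'n \<Rightarrow> real^'n) \<Rightarrow> (real^'n) set \<Rightarrow> real^'n^'n \<Rightarrow> real^'n \<Rightarrow> real^'n" where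
  "comp_grad \<Psi> dh Z R y = R *v (y - comp_step \<Psi> dh Z R y)"

text \<open>One pass of the accelerated scheme maps the state \<open>(y, z, t)\<close> of index \<open>k - 1\<close> to that of
  index \<open>k\<close>. The parameter \<open>T\<close> stands for \<open>comp_step\<close>, and \<open>N y\<close> for the norm of \<open>comp_grad\<close> at \<open>y\<close>
  weighted by the inverse of \<open>R\<close>.\<close>

type_synonym 'v fista_state = "'v \<times> 'v \<times> real"

definition fista_step :: "('v::real_vector \<Rightarrow> 'v) \<Rightarrow> 'v fista_state \<Rightarrow> 'v fista_state" where
  "fista_step T = (\<lambda>(y, z, t).
     let z' = T y;
         t' = (1 + sqrt (1 + 4 * t\<^sup>2)) / 2;
         y' = z' + ((t - 1) / t') *\<^sub>R (z' - z)
     in (y', z', t'))"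

fun fista :: "('v::real_vector \<Rightarrow> 'v) \<Rightarrow> 'v \<Rightarrow> nat \<Rightarrow> 'v fista_state" where
  "fista T r0 0 = (T r0, T r0, 1)"
| "fista T r0 (Suc k) = fista_step T (fista T r0 k)"

definition fista_y :: "('v::real_vector \<Rightarrow> 'v) \<Rightarrow> 'v \<Rightarrow> nat \<Rightarrow> 'v" where
  "fista_y T r0 k = fst (fista T r0 k)"

text \<open>State at the end of an iteration of the restarted algorithm. The field \<open>y_computed\<close> is the
  extrapolated point before a possible reset; \<open>carried\<close> is what the next iteration starts from
  (after a possible reset); \<open>restarts\<close> is the counter \<open>j\<close> and \<open>rho\<close> is \<open>\<rho>\<^sub>j\<close> for its current
  value. The recursion runs forever; the exit test is imposed afterwards by \<open>gbr_performed\<close> and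
  \<open>gbr_exit\<close>, as it does not influence the iterates.\<close>

record 'v gbr_state =
  y_computed :: 'v
  carried :: "'v fista_state"
  restarts :: nat
  rho :: real

definition gbr_step ::
  "('v::real_vector \<Rightarrow> 'v) \<Rightarrow> ('v \<Rightarrow> real) \<Rightarrow> 'v gbr_state \<Rightarrow> 'v gbr_state" where
  "gbr_step T N s =
     (let s' = fista_step T (carried s); y = fst s' in
      if N y \<le> rho s / exp 1
      then \<lparr>y_computed = y, carried = (T y, T y, 1), restarts = restarts s + 1, rho = N y\<rparr>
      else \<lparr>y_computed = y, carried = s', restarts = restarts s, rho = rho s\<rparr>)"

fun gbr :: "('v::real_vector \<Rightarrow> 'v) \<Rightarrow> ('v \<Rightarrow> real) \<Rightarrow> 'v \<Rightarrow> nat \<Rightarrow> 'v gbr_state" where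
  "gbr T N r0 0 = \<lparr>y_computed = T r0, carried = (T r0, T r0, 1), restarts = 0, rho = N r0\<rparr>"
| "gbr T N r0 (Suc k) = gbr_step T N (gbr T N r0 k)"

definition gbr_y :: "('v::real_vector \<Rightarrow> 'v) \<Rightarrow> ('v \<Rightarrow> real) \<Rightarrow> 'v \<Rightarrow> nat \<Rightarrow> 'v" where
  "gbr_y T N r0 k = y_computed (gbr T N r0 k)"

text \<open>The loop is of repeat-until form: the exit test is made only after an iteration, so never at
  index \<open>0\<close>, and at least one iteration is performed.\<close>

definition gbr_performed ::
  "('v::real_vector \<Rightarrow> 'v) \<Rightarrow> ('v \<Rightarrow> real) \<Rightarrow> 'v \<Rightarrow> real \<Rightarrow> nat \<Rightarrow> bool" where
  "gbr_performed T N r0 \<epsilon> k \<longleftrightarrow> (\<forall>i. 1 \<le> i \<and> i < k \<longrightarrow> \<not> rho (gbr T N r0 i) \<le> \<epsilon>)"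

definition gbr_exit ::
  "('v::real_vector \<Rightarrow> 'v) \<Rightarrow> ('v \<Rightarrow> real) \<Rightarrow> 'v \<Rightarrow> real \<Rightarrow> nat \<Rightarrow> bool" where
  "gbr_exit T N r0 \<epsilon> k \<longleftrightarrow> 1 \<le> k \<and> gbr_performed T N r0 \<epsilon> k \<and> rho (gbr T N r0 k) \<le> \<epsilon>"

end

theory Submission
  imports Defs
begin

text \<open>
  Write \<open>\<parallel>\<cdot>\<parallel>\<close> for the norm weighted by \<open>R\<close>, \<open>T\<close> for the composite gradient step and \<open>N y\<close> for the
  weighted norm of the gradient mapping at \<open>y\<close>. Since the weight is \<open>R\<inverse>\<close> and the mapping is
  \<open>R (y - T y)\<close>, one has \<open>N y = \<parallel>y - T y\<parallel>\<close>. Strong convexity of the model minimised by \<open>T\<close> and the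
  two-sided bounds on \<open>h\<close> give, for feasible \<open>z\<close>,
  \<open>f (T y) + \<parallel>z - T y\<parallel>\<^sup>2 / 2 \<le> f z + \<parallel>z - y\<parallel>\<^sup>2 / 2\<close> (\<open>gradient_step_inequality\<close>); everything else
  rests on this inequality.

  Applied to the projection \<open>s\<close> of \<open>T r\<^sub>0\<close> onto the optimal set and combined with quadratic growth, it
  gives a quadratic inequality for \<open>\<parallel>T r\<^sub>0 - s\<parallel>\<close> whose solution is
  \<open>\<parallel>T r\<^sub>0 - s\<parallel> \<le> (1 + sqrt (\<mu> + 1)) / \<mu> * N r\<^sub>0\<close> (\<open>optimal_point_near_gradient_step\<close>).

  Applied along the accelerated scheme with \<open>u = t y - (t - 1) z\<close>, it shows that
  \<open>2 (t\<^sup>2 - t) (f z - f\<^sup>*) + \<parallel>u - s\<parallel>\<^sup>2\<close> never increases. So \<open>u\<close> stays within distance \<open>\<parallel>T r\<^sub>0 - s\<parallel>\<close> of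
  \<open>s\<close>, and since one iteration moves \<open>u\<close> by exactly \<open>t (T y - y)\<close>, the gradient mapping satisfies
  \<open>t * N y \<le> 2 \<parallel>T r\<^sub>0 - s\<parallel>\<close>. With \<open>t \<ge> (k + 2) / 2\<close> this is
  \<open>(k + 2) * N y\<^sub>k \<le> 4 \<parallel>T r\<^sub>0 - s\<parallel>\<close> (\<open>fista_gradient_bound\<close>), which contains the first two claims.

  The summand \<open>2\<close> is what makes the restart bounds hold without rounding losses: a cycle between
  restarts is an integer number of iterations, and with \<open>k + 2\<close> in place of \<open>k\<close> that integer is at
  most \<open>\<lfloor>a\<rfloor>\<close> instead of only \<open>\<lceil>a\<rceil>\<close>. Each restart divides \<open>\<rho>\<close> by at least \<open>e\<close>, so after \<open>k\<close> iterations
  at least \<open>\<lfloor>k / a\<rfloor>\<close> restarts have taken place (\<open>gbr_invariant\<close>), and \<open>\<lfloor>a\<rfloor> J\<close> iterations contain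
  \<open>J\<close> restarts.
\<close>

section \<open>The inner product of a positive definite matrix\<close>

text \<open>The inner product \<open>x\<^sup>T M y\<close> behind \<^const>\<open>wnorm\<close>.\<close>

definition wip :: "real^'n^'n \<Rightarrow> real^'n \<Rightarrow> real^'n \<Rightarrow> real" where
  "wip M x y = x \<bullet> (M *v y)"

lemma wip_simps [simp]:
  "wip M (x + y) z = wip M x z + wip M y z"
  "wip M x (y + z) = wip M x y + wip M x z"
  "wip M (x - y) z = wip M x z - wip M y z"
  "wip M x (y - z) = wip M x y - wip M x z"
  "wip M (c *\<^sub>R x) y = c * wip M x y"
  "wip M x (c *\<^sub>R y) = c * wip M x y"
  by (simp_all add: wip_def inner_simps algebra_simps)

lemma wip_commute: "sym_pos_def M \<Longrightarrow> wip M x y = wip M y x"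
  unfolding wip_def sym_pos_def_def
  by (metis dot_lmul_matrix inner_commute vector_transpose_matrix)

lemma wip_nonneg: "sym_pos_def M \<Longrightarrow> 0 \<le> wip M x x"
  unfolding wip_def sym_pos_def_def
  by (metis inner_zero_left less_eq_real_def)

lemma wnorm_square: "sym_pos_def M \<Longrightarrow> (wnorm M x)\<^sup>2 = wip M x x"
  using wip_nonneg[of M x] by (simp add: wnorm_def wip_def)

lemma wnorm_nonneg: "sym_pos_def M \<Longrightarrow> 0 \<le> wnorm M x"
  using wip_nonneg[of M x] by (simp add: wnorm_def wip_def)

lemma wnorm_square_minus_commute:
  "sym_pos_def M \<Longrightarrow> (wnorm M (x - y))\<^sup>2 = (wnorm M (y - x))\<^sup>2"
  by (simp add: wnorm_square)

lemma wnorm_square_scaleR: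
  "sym_pos_def M \<Longrightarrow> (wnorm M (c *\<^sub>R x))\<^sup>2 = c\<^sup>2 * (wnorm M x)\<^sup>2"
  by (simp add: wnorm_square power2_eq_square[of c])

text \<open>The Cauchy--Schwarz inequality.\<close>

lemma wip_le_wnorm_mult:
  assumes M: "sym_pos_def M"
  shows "wip M x y \<le> wnorm M x * wnorm M y"
proof (cases "x = 0 \<or> y = 0")
  case True
  then show ?thesis by (auto simp: wip_def wnorm_def)
next
  case False
  define a b where "a = wnorm M x" and "b = wnorm M y"
  have pos: "0 < a" "0 < b"
    using M False by (auto simp: a_def b_def wnorm_def sym_pos_def_def)
  have "0 \<le> wip M (b *\<^sub>R x - a *\<^sub>R y) (b *\<^sub>R x - a *\<^sub>R y)"
    using M by (rule wip_nonneg)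
  also have "\<dots> = b\<^sup>2 * a\<^sup>2 + a\<^sup>2 * b\<^sup>2 - 2 * (a * b) * wip M x y"
    unfolding a_def b_def wnorm_square[OF M]
    by (simp add: wnorm_square[OF M, symmetric] wip_commute[OF M, of y x] power2_eq_square algebra_simps)
  also have "\<dots> = 2 * (a * b) * (a * b - wip M x y)"
    by (simp add: power2_eq_square algebra_simps)
  finally have "0 \<le> a * b - wip M x y"
    using mult_pos_pos[OF pos] by (simp add: zero_le_mult_iff del: diff_ge_0_iff_ge)
  then show ?thesis by (simp add: a_def b_def)
qed

lemma continuous_on_wnorm:
  "continuous_on S g \<Longrightarrow> continuous_on S (\<lambda>v. wnorm M (g v))"
  unfolding wnorm_def
  by (intro continuous_intros continuous_on_compose2[OF matrix_vector_mult_linear_continuous_on[of UNIV]]) auto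

lemma wnorm_lower_bound:
  assumes M: "sym_pos_def M"
  obtains c where "0 < c" "\<And>x. c * (norm x)\<^sup>2 \<le> (wnorm M x)\<^sup>2"
proof -
  have "\<exists>x\<in>sphere 0 1. \<forall>y\<in>sphere 0 1. wip M x x \<le> wip M y y"
    unfolding wip_def
    by (rule continuous_attains_inf) (auto intro!: continuous_intros)
  then obtain x0 where x0: "norm x0 = 1" "\<And>y. norm y = 1 \<Longrightarrow> wip M x0 x0 \<le> wip M y y"
    by (auto simp: dist_norm)
  show thesis
  proof
    show "0 < wip M x0 x0"
      using M x0(1) unfolding wip_def sym_pos_def_def by (metis norm_zero zero_neq_one)
    fix x
    show "wip M x0 x0 * (norm x)\<^sup>2 \<le> (wnorm M x)\<^sup>2"
    proof (cases "x = 0")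
      case False
      then have "wip M x0 x0 \<le> wip M (inverse (norm x) *\<^sub>R x) (inverse (norm x) *\<^sub>R x)"
        by (intro x0(2)) simp
      then show ?thesis
        using False by (simp add: wnorm_square[OF M] field_simps power2_eq_square[of "norm x"])
    qed (simp add: wnorm_square[OF M] wip_def)
  qed
qed

lemma wnorm_matrix_inv:
  assumes M: "sym_pos_def M"
  shows "wnorm (matrix_inv M) (M *v x) = wnorm M x"
proof -
  have "\<exists>B. B ** M = mat 1"
    unfolding matrix_left_invertible_ker
    using M by (metis inner_zero_right less_irrefl sym_pos_def_def)
  then have "invertible M"
    by (simp add: invertible_left_inverse)
  then have "matrix_inv M ** M = mat 1"
    using someI_ex[of "\<lambda>A'. M ** A' = mat 1 \<and> A' ** M = mat 1"]
    unfolding invertible_def matrix_inv_def by blast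
  then have "matrix_inv M *v (M *v x) = x"
    by (metis matrix_vector_mul_assoc matrix_vector_mul_lid)
  then show ?thesis
    by (simp add: wnorm_def inner_commute)
qed


section \<open>The composite problem and its gradient step\<close>

text \<open>A convex function lies above its tangent plane; the one-dimensional statement is applied on
  the line through the two points.\<close>

lemma convex_gradient_inequality:
  assumes h: "convex_on UNIV h" "GDERIV h y :> g"
  shows "h y + g \<bullet> (z - y) \<le> h z"
proof -
  define p where "p = (\<lambda>s::real. h (y + s *\<^sub>R (z - y)))"
  have "convex_on UNIV p"
  proof (rule convex_onI)
    fix t a b :: real
    assume t: "0 < t" "t < 1"
    have "y + ((1 - t) *\<^sub>R a + t *\<^sub>R b) *\<^sub>R (z - y)
        = (1 - t) *\<^sub>R (y + a *\<^sub>R (z - y)) + t *\<^sub>R (y + b *\<^sub>R (z - y))"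
      by (simp add: algebra_simps)
    then show "p ((1 - t) *\<^sub>R a + t *\<^sub>R b) \<le> (1 - t) * p a + t * p b"
      using convex_onD[OF h(1), of t "y + a *\<^sub>R (z - y)" "y + b *\<^sub>R (z - y)"] t
      by (simp add: p_def)
  qed simp
  moreover have "(p has_field_derivative g \<bullet> (z - y)) (at 0)"
  proof -
    have "(h has_derivative (\<lambda>d. d \<bullet> g)) (at (y + 0 *\<^sub>R (z - y)))"
      using h(2) by (simp add: gderiv_def)
    moreover have "((\<lambda>s. y + s *\<^sub>R (z - y)) has_derivative (\<lambda>s. s *\<^sub>R (z - y))) (at 0)"
      by (auto intro!: derivative_eq_intros)
    ultimately have "((\<lambda>s. h (y + s *\<^sub>R (z - y))) has_derivative (\<lambda>s. (s *\<^sub>R (z - y)) \<bullet> g)) (at 0)"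
      by (rule has_derivative_compose[rotated])
    moreover have "(\<lambda>s. (s *\<^sub>R (z - y)) \<bullet> g) = (*) (g \<bullet> (z - y))"
      by (simp add: fun_eq_iff inner_commute mult.commute)
    ultimately show ?thesis
      unfolding has_field_derivative_def p_def by simp
  qed
  ultimately have "p 1 - p 0 \<ge> (g \<bullet> (z - y)) * (1 - 0)"
    by (intro convex_on_imp_above_tangent[where A = UNIV]) auto
  then show ?thesis by (simp add: p_def)
qed

text \<open>The data of the problem under the standing assumptions, without quadratic growth.\<close>

locale composite_problem =
  fixes \<Psi> :: "real^'n \<Rightarrow> ereal"
    and h :: "real^'n \<Rightarrow> real"
    and dh :: "real^'n \<Rightarrow> real^'n"
    and Z :: "(real^'n) set"
    and R :: "real^'n^'n"
  assumes proper: "proper_fun \<Psi>" and closed_Psi: "closed_fun \<Psi>" and convex_Psi: "convex_fun \<Psi>"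
    and gradient: "\<And>y. GDERIV h y :> dh y" and convex_h: "convex_on UNIV h"
    and R: "sym_pos_def R"
    and descent: "\<And>z y. h z \<le> h y + dh y \<bullet> (z - y) + 1 / 2 * (wnorm R (z - y))\<^sup>2"
    and closed_Z: "closed Z" and convex_Z: "convex Z"
    and optimum: "\<exists>zs \<in> Z \<inter> edom \<Psi>. objective \<Psi> h zs = opt_value (objective \<Psi> h) Z"
begin

text \<open>The feasible points of finite objective. All work with \<open>\<Psi>\<close> takes place on this convex set,
  where it is replaced by the real-valued function \<open>\<psi>\<close>; off the domain the value of \<open>\<psi>\<close> is
  irrelevant.\<close>

definition D :: "(real^'n) set" where
  "D = Z \<inter> edom \<Psi>"

definition \<psi> :: "real^'n \<Rightarrow> real" where
  "\<psi> z = real_of_ereal (\<Psi> z)"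

text \<open>The objective and its optimal value, as real numbers.\<close>

definition F :: "real^'n \<Rightarrow> real" where
  "F z = \<psi> z + h z"

definition Fopt :: real where
  "Fopt = (INF z\<in>D. F z)"

text \<open>The quadratic upper model of the objective at \<open>y\<close>, up to the constant \<open>h y\<close>; its minimiser
  over the feasible set is the composite gradient step.\<close>

definition model :: "real^'n \<Rightarrow> real^'n \<Rightarrow> real" where
  "model y z = \<psi> z + dh y \<bullet> (z - y) + 1 / 2 * (wnorm R (z - y))\<^sup>2"

abbreviation \<T> :: "real^'n \<Rightarrow> real^'n" where
  "\<T> \<equiv> comp_step \<Psi> dh Z R"

lemma Psi_eq: "z \<in> D \<Longrightarrow> \<Psi> z = ereal (\<psi> z)"
  using proper unfolding proper_fun_def D_def edom_def \<psi>_def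
  by (metis IntD2 ereal_real' less_irrefl mem_Collect_eq abs_eq_infinity_cases)

lemma Psi_infinite: "z \<in> Z \<Longrightarrow> z \<notin> D \<Longrightarrow> \<Psi> z = \<infinity>"
  by (auto simp: D_def edom_def)

lemma epi_iff: "z \<in> Z \<Longrightarrow> (z, r) \<in> epi \<Psi> \<longleftrightarrow> z \<in> D \<and> \<psi> z \<le> r"
  using Psi_eq[of z] Psi_infinite[of z] by (cases "z \<in> D") (auto simp: epi_def)

lemma convex_combination:
  assumes "a \<in> D" "b \<in> D" "0 \<le> s" "s \<le> 1"
  shows "(1 - s) *\<^sub>R a + s *\<^sub>R b \<in> D"
    and "\<psi> ((1 - s) *\<^sub>R a + s *\<^sub>R b) \<le> (1 - s) * \<psi> a + s * \<psi> b"
proof -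
  have Z: "a \<in> Z" "b \<in> Z" using assms by (auto simp: D_def)
  then have "(1 - s) *\<^sub>R a + s *\<^sub>R b \<in> Z"
    using convexD_alt[OF convex_Z] assms by blast
  moreover have "(1 - s) *\<^sub>R (a, \<psi> a) + s *\<^sub>R (b, \<psi> b) \<in> epi \<Psi>"
    using convexD_alt[of "epi \<Psi>" "(a, \<psi> a)" "(b, \<psi> b)" s] convex_Psi assms Z
    by (simp add: convex_fun_def epi_iff)
  ultimately show "(1 - s) *\<^sub>R a + s *\<^sub>R b \<in> D"
      "\<psi> ((1 - s) *\<^sub>R a + s *\<^sub>R b) \<le> (1 - s) * \<psi> a + s * \<psi> b"
    by (simp_all add: epi_iff)
qed

lemma F_convex:
  assumes "a \<in> D" "b \<in> D" "0 \<le> s" "s \<le> 1"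
  shows "F ((1 - s) *\<^sub>R a + s *\<^sub>R b) \<le> (1 - s) * F a + s * F b"
  using convex_combination(2)[OF assms] convex_onD[OF convex_h, of s a b] assms
  by (simp add: F_def algebra_simps)

text \<open>Closedness of the epigraph in sequential form: \<open>\<psi>\<close> is lower semicontinuous on \<open>D\<close>, and a
  limit of feasible points of bounded value is feasible.\<close>

lemma D_limit:
  assumes "\<And>n. a n \<in> D" "a \<longlonglongrightarrow> l" "\<And>n. \<psi> (a n) \<le> r n" "r \<longlonglongrightarrow> m"
  shows "l \<in> D" "\<psi> l \<le> m"
proof -
  have "l \<in> Z"
    using closed_sequentially[OF closed_Z] assms(1,2) by (auto simp: D_def)
  moreover have "(l, m) \<in> epi \<Psi>"
  proof (rule closed_sequentially)
    show "closed (epi \<Psi>)" using closed_Psi by (simp add: closed_fun_def)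
    show "(\<lambda>n. (a n, r n)) \<longlonglongrightarrow> (l, m)" using assms by (intro tendsto_Pair)
    show "(a n, r n) \<in> epi \<Psi>" for n using assms(1,3)[of n] epi_iff[of "a n"] by (simp add: D_def)
  qed
  ultimately show "l \<in> D" "\<psi> l \<le> m" by (simp_all add: epi_iff)
qed

lemma minimizer_exists: "\<exists>zs\<in>D. (\<forall>z\<in>D. F zs \<le> F z) \<and> opt_value (objective \<Psi> h) Z = ereal (F zs)"
proof -
  obtain zs where zs: "zs \<in> D" "objective \<Psi> h zs = opt_value (objective \<Psi> h) Z"
    using optimum by (auto simp: D_def)
  have obj: "objective \<Psi> h z = ereal (F z)" if "z \<in> D" for z
    using Psi_eq[OF that] by (simp add: objective_def F_def)
  have "ereal (F zs) \<le> ereal (F z)" if "z \<in> D" for z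
  proof -
    have "opt_value (objective \<Psi> h) Z \<le> objective \<Psi> h z"
      unfolding opt_value_def using that by (intro INF_lower) (auto simp: D_def)
    then show ?thesis using obj zs that by simp
  qed
  then show ?thesis using zs obj by (intro bexI[of _ zs]) auto
qed

lemma D_nonempty: "D \<noteq> {}"
  using minimizer_exists by blast

lemma opt_value_eq: "opt_value (objective \<Psi> h) Z = ereal Fopt"
  and Fopt_le: "z \<in> D \<Longrightarrow> Fopt \<le> F z"
proof -
  obtain zs where zs: "zs \<in> D" "\<forall>z\<in>D. F zs \<le> F z" "opt_value (objective \<Psi> h) Z = ereal (F zs)"
    using minimizer_exists by blast
  have "Fopt = F zs"
    unfolding Fopt_def using zs by (intro cInf_eq_minimum) auto
  then show "opt_value (objective \<Psi> h) Z = ereal Fopt" "z \<in> D \<Longrightarrow> Fopt \<le> F z"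
    using zs by auto
qed

lemma opt_set_eq: "opt_set (objective \<Psi> h) Z = {z \<in> D. F z = Fopt}"
proof -
  have "z \<in> D" if "z \<in> Z" "objective \<Psi> h z = ereal Fopt" for z
    using that Psi_infinite[of z] by (cases "z \<in> D") (auto simp: objective_def)
  moreover have "z \<in> Z" "objective \<Psi> h z = ereal (F z)" if "z \<in> D" for z
    using that Psi_eq[OF that] by (auto simp: D_def objective_def F_def)
  ultimately show ?thesis
    unfolding opt_set_def opt_value_eq by (metis (no_types, lifting) ereal.inject)
qed

lemma opt_set_nonempty: "opt_set (objective \<Psi> h) Z \<noteq> {}"
  using optimum by (auto simp: opt_set_def)

lemma isCont_h: "isCont h y"
  using gradient by (meson gderiv_def has_derivative_continuous)

lemma closed_opt_set: "closed (opt_set (objective \<Psi> h) Z)"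
  unfolding closed_sequential_limits
proof (intro allI impI, elim conjE)
  fix a l
  assume a: "\<forall>n. a n \<in> opt_set (objective \<Psi> h) Z" and lim: "a \<longlonglongrightarrow> l"
  have D: "a n \<in> D" "F (a n) = Fopt" for n using a by (auto simp: opt_set_eq)
  have "(\<lambda>n. Fopt - h (a n)) \<longlonglongrightarrow> Fopt - h l"
    by (intro tendsto_intros isCont_tendsto_compose[OF isCont_h lim])
  moreover have "\<psi> (a n) \<le> Fopt - h (a n)" for n
    using D(2)[of n] by (simp add: F_def)
  ultimately have "l \<in> D" "\<psi> l \<le> Fopt - h l"
    using D_limit[OF D(1) lim, of "\<lambda>n. Fopt - h (a n)"] by blast+
  then show "l \<in> opt_set (objective \<Psi> h) Z"
    using Fopt_le[of l] by (simp add: opt_set_eq F_def)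
qed

text \<open>The projection is a choice among minimisers, so that it is meaningful only because a nearest
  point exists: the optimal set is closed and the weighted balls are bounded.\<close>

lemma wproj_in_opt_set: "wproj R (opt_set (objective \<Psi> h) Z) z \<in> opt_set (objective \<Psi> h) Z"
proof -
  let ?S = "opt_set (objective \<Psi> h) Z"
  obtain s0 where s0: "s0 \<in> ?S" using opt_set_nonempty by blast
  obtain c where c: "0 < c" "\<And>x. c * (norm x)\<^sup>2 \<le> (wnorm R x)\<^sup>2"
    using wnorm_lower_bound[OF R] by blast
  define b where "b = (wnorm R (s0 - z))\<^sup>2 / c"
  let ?K = "?S \<inter> cball z (sqrt b)"
  have cont: "continuous_on ?K (\<lambda>v. wnorm R (v - z))"
    by (intro continuous_intros continuous_on_wnorm)
  \<comment> \<open>Points no farther than \<open>s0\<close> in the weighted norm lie in a Euclidean ball.\<close>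
  have ball: "v \<in> cball z (sqrt b)" if "wnorm R (v - z) \<le> wnorm R (s0 - z)" for v
  proof -
    have "c * (norm (v - z))\<^sup>2 \<le> (wnorm R (s0 - z))\<^sup>2"
      using c(2)[of "v - z"] power_mono[OF that wnorm_nonneg[OF R], of 2] by linarith
    then have "(norm (v - z))\<^sup>2 \<le> b"
      using c(1) by (simp add: b_def field_simps)
    then show ?thesis
      by (simp add: dist_norm norm_minus_commute real_le_rsqrt)
  qed
  have "compact ?K" using closed_opt_set by (simp add: closed_Int_compact)
  moreover have "?K \<noteq> {}" using s0 ball[of s0] by auto
  ultimately obtain p where p: "p \<in> ?K" "\<And>v. v \<in> ?K \<Longrightarrow> wnorm R (p - z) \<le> wnorm R (v - z)"
    using continuous_attains_inf[OF _ _ cont] by blast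
  have min: "wnorm R (p - z) \<le> wnorm R (v - z)" if "v \<in> ?S" for v
  proof (cases "wnorm R (v - z) \<le> wnorm R (s0 - z)")
    case True
    then show ?thesis using p(2) that ball by blast
  next
    case False
    then show ?thesis using p(2)[of s0] s0 ball[of s0] by simp
  qed
  show ?thesis
    unfolding wproj_def arg_min_on_def
    by (rule arg_minI[where x = p]) (use p(1) min in \<open>auto simp: not_less\<close>)
qed

lemma model_strongly_convex:
  assumes "a \<in> D" "b \<in> D" "0 \<le> s" "s \<le> 1"
  shows "model y ((1 - s) *\<^sub>R a + s *\<^sub>R b)
    \<le> (1 - s) * model y a + s * model y b - 1 / 2 * s * (1 - s) * (wnorm R (a - b))\<^sup>2"
proof -
  define u v where "u = a - y" and "v = b - y"
  have "(1 - s) *\<^sub>R a + s *\<^sub>R b - y = (1 - s) *\<^sub>R u + s *\<^sub>R v" and "a - b = u - v"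
    unfolding u_def v_def by (simp_all add: algebra_simps)
  moreover have "(wnorm R ((1 - s) *\<^sub>R u + s *\<^sub>R v))\<^sup>2
      = (1 - s) * (wnorm R u)\<^sup>2 + s * (wnorm R v)\<^sup>2 - s * (1 - s) * (wnorm R (u - v))\<^sup>2"
    by (simp add: wnorm_square[OF R] wip_commute[OF R, of v u] algebra_simps)
  moreover have "dh y \<bullet> ((1 - s) *\<^sub>R u + s *\<^sub>R v) = (1 - s) * (dh y \<bullet> u) + s * (dh y \<bullet> v)"
    by (simp add: inner_simps)
  ultimately have "model y ((1 - s) *\<^sub>R a + s *\<^sub>R b) = \<psi> ((1 - s) *\<^sub>R a + s *\<^sub>R b)
      + ((1 - s) * (dh y \<bullet> u) + s * (dh y \<bullet> v))
      + 1 / 2 * ((1 - s) * (wnorm R u)\<^sup>2 + s * (wnorm R v)\<^sup>2 - s * (1 - s) * (wnorm R (a - b))\<^sup>2)"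
    by (simp only: model_def)
  also have "\<dots> \<le> ((1 - s) * \<psi> a + s * \<psi> b)
      + ((1 - s) * (dh y \<bullet> u) + s * (dh y \<bullet> v))
      + 1 / 2 * ((1 - s) * (wnorm R u)\<^sup>2 + s * (wnorm R v)\<^sup>2 - s * (1 - s) * (wnorm R (a - b))\<^sup>2)"
    using convex_combination(2)[OF assms] by simp
  also have "\<dots> = (1 - s) * model y a + s * model y b - 1 / 2 * s * (1 - s) * (wnorm R (a - b))\<^sup>2"
    by (simp add: model_def field_simps flip: u_def v_def)
  finally show ?thesis .
qed

text \<open>The model, plus \<open>h y\<close>, majorises the objective, hence is bounded below by the optimal value.
  This replaces an affine minorant of \<open>\<Psi>\<close>.\<close>

lemma model_lower_bound: "z \<in> D \<Longrightarrow> Fopt - h y \<le> model y z"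
  using Fopt_le[of z] descent[of z y] by (simp add: F_def model_def)

text \<open>By strong convexity a minimising sequence of the model is a Cauchy sequence; its limit is a
  minimiser because \<open>\<psi>\<close> is lower semicontinuous.\<close>

lemma model_minimizer_exists: "\<exists>p\<in>D. \<forall>z\<in>D. model y p \<le> model y z"
proof -
  define m where "m = (INF z\<in>D. model y z)"
  define \<delta> :: "nat \<Rightarrow> real" where "\<delta> = (\<lambda>n. inverse (real (Suc n)))"
  have \<delta>: "\<delta> \<longlonglongrightarrow> 0" "0 < \<delta> n" "i \<le> j \<Longrightarrow> \<delta> j \<le> \<delta> i" for n i j
    unfolding \<delta>_def by (simp_all only: LIMSEQ_inverse_real_of_nat) (auto intro: le_imp_inverse_le)
  have bdd: "bdd_below (model y ` D)"
    using model_lower_bound by (intro bdd_belowI2)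
  have m_le: "m \<le> model y z" if "z \<in> D" for z
    unfolding m_def using bdd that by (rule cINF_lower)
  have "\<exists>z\<in>D. model y z < m + \<delta> n" for n
    using cINF_less_iff[OF D_nonempty bdd, of "m + \<delta> n"] \<delta>(2)[of n] by (simp add: m_def)
  then obtain a where a: "\<And>n. a n \<in> D" "\<And>n. model y (a n) < m + \<delta> n"
    by metis
  obtain c where c: "0 < c" "\<And>x. c * (norm x)\<^sup>2 \<le> (wnorm R x)\<^sup>2"
    using wnorm_lower_bound[OF R] by blast
  have close: "c * (norm (a i - a j))\<^sup>2 \<le> 4 * (\<delta> i + \<delta> j)" for i j
  proof -
    \<comment> \<open>Compare the infimum with the value at the midpoint.\<close>
    have "m \<le> model y ((1 - 1/2) *\<^sub>R a i + (1/2) *\<^sub>R a j)"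
      by (intro m_le convex_combination a) auto
    also have "\<dots> \<le> (1 - 1/2) * model y (a i) + 1/2 * model y (a j)
        - 1/2 * (1/2) * (1 - 1/2) * (wnorm R (a i - a j))\<^sup>2"
      by (intro model_strongly_convex a) auto
    finally show ?thesis
      using a(2)[of i] a(2)[of j] c(2)[of "a i - a j"] by simp
  qed
  have "Cauchy a"
  proof (rule metric_CauchyI)
    fix e :: real assume e: "0 < e"
    define q where "q = c * e\<^sup>2 / 8"
    have "0 < q" using e c(1) by (simp add: q_def)
    then obtain M where M: "\<delta> M < q"
      unfolding \<delta>_def using reals_Archimedean by blast
    have "dist (a i) (a j) < e" if "M \<le> i" "M \<le> j" for i j
    proof -
      have "\<delta> i \<le> \<delta> M" "\<delta> j \<le> \<delta> M"
        using that by (auto intro: \<delta>(3))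
      then have "4 * (\<delta> i + \<delta> j) < 8 * q"
        using M by simp
      then have "c * (norm (a i - a j))\<^sup>2 < 8 * q"
        using close by (rule le_less_trans[rotated])
      then have "(norm (a i - a j))\<^sup>2 < e\<^sup>2"
        using c(1) by (simp add: q_def)
      then show ?thesis
        using e by (simp add: dist_norm power_less_imp_less_base)
    qed
    then show "\<exists>M. \<forall>i\<ge>M. \<forall>j\<ge>M. dist (a i) (a j) < e" by blast
  qed
  then obtain p where p: "a \<longlonglongrightarrow> p"
    using Cauchy_convergent_iff convergent_def by blast
  define q where "q = (\<lambda>z. dh y \<bullet> (z - y) + 1 / 2 * (wnorm R (z - y))\<^sup>2)"
  have "continuous_on UNIV q"
    unfolding q_def by (intro continuous_intros continuous_on_wnorm)
  then have "(\<lambda>n. q (a n)) \<longlonglongrightarrow> q p"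
    using p by (simp add: continuous_on_eq_continuous_at isCont_tendsto_compose)
  then have "(\<lambda>n. m + \<delta> n - q (a n)) \<longlonglongrightarrow> m + 0 - q p"
    by (intro tendsto_intros \<delta>(1))
  moreover have "\<psi> (a n) \<le> m + \<delta> n - q (a n)" for n
    using a(2)[of n] by (simp add: model_def q_def)
  ultimately have "p \<in> D" "\<psi> p \<le> m + 0 - q p"
    using D_limit[OF a(1) p, of "\<lambda>n. m + \<delta> n - q (a n)"] by blast+
  then have "p \<in> D" "model y p \<le> m" by (simp_all add: model_def q_def)
  then show ?thesis
    using m_le order_trans by blast
qed

lemma T_in_D: "\<T> y \<in> D" and T_minimal: "z \<in> D \<Longrightarrow> model y (\<T> y) \<le> model y z"
proof -
  let ?g = "\<lambda>z. \<Psi> z + ereal (dh y \<bullet> (z - y) + 1 / 2 * (wnorm R (z - y))\<^sup>2)"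
  have g: "?g z = ereal (model y z)" if "z \<in> D" for z
    using Psi_eq[OF that] by (simp add: model_def)
  have g_inf: "?g z = \<infinity>" if "z \<in> Z" "z \<notin> D" for z
    using Psi_infinite[OF that] by simp
  obtain p where p: "p \<in> D" "\<And>z. z \<in> D \<Longrightarrow> model y p \<le> model y z"
    using model_minimizer_exists[of y] by blast
  have "\<T> y \<in> D \<and> (\<forall>z\<in>D. model y (\<T> y) \<le> model y z)"
    unfolding comp_step_def arg_min_on_def
  proof (rule arg_minI[where x = p])
    show "p \<in> Z" using p by (simp add: D_def)
    show "\<not> ?g z < ?g p" if "z \<in> Z" for z
      using g g_inf that p by (cases "z \<in> D") (auto simp: not_less)
    show "x \<in> D \<and> (\<forall>z\<in>D. model y x \<le> model y z)"
      if "x \<in> Z" "\<forall>z. z \<in> Z \<longrightarrow> \<not> ?g z < ?g x" for x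
    proof -
      have le: "?g x \<le> ?g z" if "z \<in> D" for z
        using that \<open>\<forall>z. z \<in> Z \<longrightarrow> \<not> ?g z < ?g x\<close> by (auto simp: D_def not_less)
      have "x \<in> D"
        using le[OF p(1)] g[OF p(1)] g_inf[OF \<open>x \<in> Z\<close>] by (cases "x \<in> D") auto
      then show ?thesis using le g by simp
    qed
  qed
  then show "\<T> y \<in> D" "z \<in> D \<Longrightarrow> model y (\<T> y) \<le> model y z" by auto
qed

text \<open>A strongly convex function grows quadratically away from its minimiser.\<close>

lemma model_growth:
  assumes z: "z \<in> D"
  shows "model y (\<T> y) + 1 / 2 * (wnorm R (z - \<T> y))\<^sup>2 \<le> model y z"
proof -
  define q where "q = (wnorm R (\<T> y - z))\<^sup>2"
  \<comment> \<open>Move from \<open>\<T> y\<close> towards \<open>z\<close> by a fraction \<open>s\<close>, then let \<open>s\<close> tend to \<open>0\<close>.\<close>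
  have bound: "1 / 2 * q \<le> model y z - model y (\<T> y) + 1 / 2 * s * q" if s: "0 < s" "s < 1" for s
  proof -
    have "model y (\<T> y) \<le> model y ((1 - s) *\<^sub>R \<T> y + s *\<^sub>R z)"
      using s z by (intro T_minimal convex_combination T_in_D) auto
    also have "\<dots> \<le> (1 - s) * model y (\<T> y) + s * model y z - 1 / 2 * s * (1 - s) * q"
      unfolding q_def using s z by (intro model_strongly_convex T_in_D) auto
    finally have "s * (1 / 2 * q) \<le> s * (model y z - model y (\<T> y) + 1 / 2 * s * q)"
      by (simp add: field_simps)
    then show ?thesis using s by simp
  qed
  have "1 / 2 * q \<le> model y z - model y (\<T> y) + 1 / 2 * 0 * q"
  proof (rule tendsto_lowerbound)
    show "((\<lambda>s. model y z - model y (\<T> y) + 1 / 2 * s * q)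
        \<longlongrightarrow> model y z - model y (\<T> y) + 1 / 2 * 0 * q) (at_right 0)"
      by (intro tendsto_intros)
    show "\<forall>\<^sub>F s in at_right 0. 1 / 2 * q \<le> model y z - model y (\<T> y) + 1 / 2 * s * q"
      using bound by (auto simp: eventually_at_right_field intro!: exI[of _ 1])
  qed simp
  then show ?thesis
    by (simp add: q_def wnorm_square_minus_commute[OF R, of "\<T> y"])
qed

lemma gradient_step_inequality:
  assumes z: "z \<in> D"
  shows "F (\<T> y) + 1 / 2 * (wnorm R (z - \<T> y))\<^sup>2 \<le> F z + 1 / 2 * (wnorm R (z - y))\<^sup>2"
  using model_growth[OF z, of y] descent[of "\<T> y" y]
    convex_gradient_inequality[OF convex_h gradient, of y z]
  by (simp add: F_def model_def)

lemma wnorm_comp_grad: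
  "wnorm (matrix_inv R) (comp_grad \<Psi> dh Z R y) = wnorm R (y - \<T> y)"
  by (simp add: comp_grad_def wnorm_matrix_inv[OF R])


section \<open>Distance to the optimal set after one gradient step\<close>

lemma optimal_point_near_gradient_step:
  assumes mu: "0 < \<mu>" and growth: "quadratic_growth \<mu> R (objective \<Psi> h) Z"
  obtains s where "s \<in> D" "F s = Fopt"
    "wnorm R (\<T> y - s) \<le> (1 + sqrt (\<mu> + 1)) / \<mu> * wnorm R (y - \<T> y)"
proof -
  define s where "s = wproj R (opt_set (objective \<Psi> h) Z) (\<T> y)"
  have s: "s \<in> D" "F s = Fopt"
    using wproj_in_opt_set[of "\<T> y"] by (auto simp: s_def opt_set_eq)
  define d n where "d = wnorm R (\<T> y - s)" and "n = wnorm R (y - \<T> y)"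
  have nonneg: "0 \<le> d" "0 \<le> n"
    by (simp_all add: d_def n_def wnorm_nonneg[OF R])
  have "objective \<Psi> h (\<T> y) = ereal (F (\<T> y))"
    using Psi_eq[OF T_in_D] by (simp add: objective_def F_def)
  moreover have "\<T> y \<in> Z" using T_in_D by (simp add: D_def)
  ultimately have "\<mu> / 2 * d\<^sup>2 \<le> F (\<T> y) - Fopt"
    using growth unfolding quadratic_growth_def opt_value_eq d_def s_def by force
  also have "\<dots> \<le> 1 / 2 * (wnorm R (s - y))\<^sup>2 - 1 / 2 * (wnorm R (s - \<T> y))\<^sup>2"
    using gradient_step_inequality[OF s(1), of y] s(2) by simp
  also have "\<dots> = 1 / 2 * n\<^sup>2 + wip R (\<T> y - s) (y - \<T> y)"
    by (simp add: n_def wnorm_square[OF R] wip_commute[OF R, of y s]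
        wip_commute[OF R, of "\<T> y" s] wip_commute[OF R, of "\<T> y" y] algebra_simps)
  also have "\<dots> \<le> 1 / 2 * n\<^sup>2 + d * n"
    using wip_le_wnorm_mult[OF R, of "\<T> y - s" "y - \<T> y"] by (simp only: d_def n_def)
  finally have "\<mu> * d\<^sup>2 \<le> n\<^sup>2 + 2 * d * n" by simp
  \<comment> \<open>Multiply by \<open>\<mu>\<close> and complete the square.\<close>
  then have "\<mu> * (\<mu> * d\<^sup>2) \<le> \<mu> * (n\<^sup>2 + 2 * d * n)"
    using mu by (intro mult_left_mono) auto
  then have "(\<mu> * d - n)\<^sup>2 \<le> (\<mu> + 1) * n\<^sup>2"
    by (simp add: power2_eq_square algebra_simps)
  then have "\<mu> * d - n \<le> sqrt ((\<mu> + 1) * n\<^sup>2)"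
    by (rule real_le_rsqrt)
  also have "\<dots> = sqrt (\<mu> + 1) * n"
    using nonneg by (simp add: real_sqrt_mult)
  finally have "d \<le> (1 + sqrt (\<mu> + 1)) / \<mu> * n"
    using mu by (simp add: field_simps)
  then show thesis using that s by (simp add: d_def n_def)
qed


section \<open>The accelerated scheme without restarts\<close>

text \<open>One accelerated iteration. The point \<open>u\<close> is the extrapolation for which \<open>y\<close> is the convex
  combination of \<open>z\<close> and \<open>u\<close> with weights \<open>1 - 1 / t\<close> and \<open>1 / t\<close>.\<close>

lemma fista_step_potential:
  assumes step: "fista_step \<T> (y, z, t) = (y', z', t')"
    and t: "1 \<le> t" and z: "z \<in> D" and s: "s \<in> D" "F s = Fopt"
  defines "u \<equiv> t *\<^sub>R y - (t - 1) *\<^sub>R z" and "u' \<equiv> t' *\<^sub>R y' - (t' - 1) *\<^sub>R z'"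
  shows "z' \<in> D" "t + 1 / 2 \<le> t'" "u' - u = t *\<^sub>R (\<T> y - y)"
    "2 * (t'\<^sup>2 - t') * (F z' - Fopt) + (wnorm R (u' - s))\<^sup>2
      \<le> 2 * (t\<^sup>2 - t) * (F z - Fopt) + (wnorm R (u - s))\<^sup>2"
proof -
  have z': "z' = \<T> y" and t': "t' = (1 + sqrt (1 + 4 * t\<^sup>2)) / 2"
    and y': "y' = z' + ((t - 1) / t') *\<^sub>R (z' - z)"
    using step by (auto simp: fista_step_def Let_def) (simp add: diff_divide_distrib)
  show "z' \<in> D" using T_in_D z' by simp
  have "2 * t \<le> sqrt (1 + 4 * t\<^sup>2)"
    by (rule real_le_rsqrt) (simp add: power_mult_distrib)
  then show "t + 1 / 2 \<le> t'" using t' by simp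
  then have t'_pos: "0 < t'" using t by simp
  have "2 * t' - 1 = sqrt (1 + 4 * t\<^sup>2)" using t' by simp
  then have "(2 * t' - 1)\<^sup>2 = 1 + 4 * t\<^sup>2" by simp
  then have t'_square: "t'\<^sup>2 - t' = t\<^sup>2" by (simp add: power2_eq_square algebra_simps)
  have u': "u' = t *\<^sub>R z' - (t - 1) *\<^sub>R z"
  proof -
    have "t' *\<^sub>R y' = t' *\<^sub>R z' + (t - 1) *\<^sub>R (z' - z)"
      using t'_pos by (simp add: y' scaleR_right_distrib)
    then show ?thesis by (simp add: u'_def algebra_simps)
  qed
  then show "u' - u = t *\<^sub>R (\<T> y - y)"
    by (simp add: u_def z' algebra_simps)
  \<comment> \<open>The comparison point that turns \<open>w - y\<close> and \<open>w - z'\<close> into multiples of \<open>s - u\<close> and \<open>s - u'\<close>.\<close>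
  define w where "w = (1 - 1 / t) *\<^sub>R z + (1 / t) *\<^sub>R s"
  have w: "w \<in> D" "F w \<le> (1 - 1 / t) * F z + 1 / t * F s"
    unfolding w_def using t z s(1) convex_combination(1)[of z s "1 / t"] F_convex[of z s "1 / t"]
    by simp_all
  have tw: "t *\<^sub>R w = (t - 1) *\<^sub>R z + s"
    using t by (simp add: w_def algebra_simps)
  have "s - u' = t *\<^sub>R (w - z')" "s - u = t *\<^sub>R (w - y)"
    by (simp_all add: u' u_def tw scaleR_diff_right)
  then have sq: "(wnorm R (u' - s))\<^sup>2 = t\<^sup>2 * (wnorm R (w - z'))\<^sup>2"
      "(wnorm R (u - s))\<^sup>2 = t\<^sup>2 * (wnorm R (w - y))\<^sup>2"
    using wnorm_square_scaleR[OF R] wnorm_square_minus_commute[OF R, of _ s] by simp_all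
  have "2 * t\<^sup>2 * (F z' + 1 / 2 * (wnorm R (w - z'))\<^sup>2)
      \<le> 2 * t\<^sup>2 * ((1 - 1 / t) * F z + 1 / t * Fopt + 1 / 2 * (wnorm R (w - y))\<^sup>2)"
    using gradient_step_inequality[OF w(1), of y] w(2) s(2) z'
    by (intro mult_left_mono) auto
  also have "\<dots> = 2 * (t\<^sup>2 - t) * F z + 2 * t * Fopt + t\<^sup>2 * (wnorm R (w - y))\<^sup>2"
    using t by (simp add: field_simps power2_eq_square)
  finally show "2 * (t'\<^sup>2 - t') * (F z' - Fopt) + (wnorm R (u' - s))\<^sup>2
      \<le> 2 * (t\<^sup>2 - t) * (F z - Fopt) + (wnorm R (u - s))\<^sup>2"
    unfolding sq t'_square by (simp add: algebra_simps)
qed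

lemma fista_invariant:
  assumes s: "s \<in> D" "F s = Fopt" and st: "fista \<T> r0 k = (y, z, t)"
  shows "z \<in> D" "(real k + 2) / 2 \<le> t"
    "2 * (t\<^sup>2 - t) * (F z - Fopt) + (wnorm R (t *\<^sub>R y - (t - 1) *\<^sub>R z - s))\<^sup>2
      \<le> (wnorm R (\<T> r0 - s))\<^sup>2"
proof -
  have "z \<in> D \<and> (real k + 2) / 2 \<le> t \<and>
    2 * (t\<^sup>2 - t) * (F z - Fopt) + (wnorm R (t *\<^sub>R y - (t - 1) *\<^sub>R z - s))\<^sup>2
      \<le> (wnorm R (\<T> r0 - s))\<^sup>2"
    using st
  proof (induction k arbitrary: y z t)
    case 0
    then show ?case using T_in_D by auto
  next
    case (Suc k)
    obtain y1 z1 t1 where st1: "fista \<T> r0 k = (y1, z1, t1)" by (metis prod_cases3)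
    have IH: "z1 \<in> D" "(real k + 2) / 2 \<le> t1"
      "2 * (t1\<^sup>2 - t1) * (F z1 - Fopt) + (wnorm R (t1 *\<^sub>R y1 - (t1 - 1) *\<^sub>R z1 - s))\<^sup>2
        \<le> (wnorm R (\<T> r0 - s))\<^sup>2"
      using Suc.IH[OF st1] by auto
    have step: "fista_step \<T> (y1, z1, t1) = (y, z, t)" using Suc.prems st1 by simp
    have "1 \<le> t1" using IH(2) by simp
    note potential = fista_step_potential[OF step this IH(1) s]
    show ?case using potential(1,2,4) IH(2,3) by simp
  qed
  then show "z \<in> D" "(real k + 2) / 2 \<le> t"
    "2 * (t\<^sup>2 - t) * (F z - Fopt) + (wnorm R (t *\<^sub>R y - (t - 1) *\<^sub>R z - s))\<^sup>2
      \<le> (wnorm R (\<T> r0 - s))\<^sup>2" by auto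
qed

text \<open>Both \<open>u\<close> and its successor lie within distance \<open>\<parallel>\<T> r0 - s\<parallel>\<close> of \<open>s\<close>, and they differ by
  \<open>t (\<T> y - y)\<close>.\<close>

lemma fista_gradient_bound:
  assumes s: "s \<in> D" "F s = Fopt"
  shows "(real k + 2) * wnorm R (fista_y \<T> r0 k - \<T> (fista_y \<T> r0 k)) \<le> 4 * wnorm R (\<T> r0 - s)"
proof -
  obtain y z t where st: "fista \<T> r0 k = (y, z, t)" by (metis prod_cases3)
  obtain y' z' t' where st': "fista \<T> r0 (Suc k) = (y', z', t')" by (metis prod_cases3)
  define u u' where "u = t *\<^sub>R y - (t - 1) *\<^sub>R z" and "u' = t' *\<^sub>R y' - (t' - 1) *\<^sub>R z'"
  define d where "d = wnorm R (\<T> r0 - s)"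
  note inv = fista_invariant[OF s st] and inv' = fista_invariant[OF s st']
  have bound: "(wnorm R (v - s))\<^sup>2 \<le> d\<^sup>2"
    if "2 * (x\<^sup>2 - x) * (F w - Fopt) + (wnorm R (v - s))\<^sup>2 \<le> d\<^sup>2" "1 \<le> x" "w \<in> D" for x v w
  proof -
    have "x \<le> x\<^sup>2" using that(2) by (simp add: power2_eq_square)
    then have "0 \<le> 2 * (x\<^sup>2 - x) * (F w - Fopt)"
      using Fopt_le[OF that(3)] by simp
    then show ?thesis using that(1) by simp
  qed
  have "(wnorm R (u - s))\<^sup>2 \<le> d\<^sup>2"
    unfolding u_def using inv(1,2) by (intro bound[OF inv(3)[folded d_def]]) auto
  moreover have "(wnorm R (u' - s))\<^sup>2 \<le> d\<^sup>2"
    unfolding u'_def using inv'(1,2) by (intro bound[OF inv'(3)[folded d_def]]) auto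
  moreover have "u' - u = (u' - s) - (u - s)" by simp
  moreover have "(wnorm R (p - q))\<^sup>2 \<le> 2 * (wnorm R p)\<^sup>2 + 2 * (wnorm R q)\<^sup>2" for p q
    using wip_nonneg[OF R, of "p + q"] wip_commute[OF R, of p q] by (simp add: wnorm_square[OF R])
  ultimately have "(wnorm R (u' - u))\<^sup>2 \<le> 4 * d\<^sup>2"
    by (smt (verit))
  moreover have "u' - u = t *\<^sub>R (\<T> y - y)"
    unfolding u_def u'_def using st' st inv(1,2) s by (intro fista_step_potential(3)) auto
  ultimately have "(t * wnorm R (y - \<T> y))\<^sup>2 \<le> (2 * d)\<^sup>2"
    by (simp add: wnorm_square_scaleR[OF R] wnorm_square_minus_commute[OF R, of y] power_mult_distrib)
  then have "t * wnorm R (y - \<T> y) \<le> 2 * d"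
    by (rule power2_le_imp_le) (simp add: d_def wnorm_nonneg[OF R])
  moreover have "(real k + 2) / 2 * wnorm R (y - \<T> y) \<le> t * wnorm R (y - \<T> y)"
    using inv(2) by (intro mult_right_mono) (simp_all add: wnorm_nonneg[OF R])
  ultimately show ?thesis by (simp add: fista_y_def st d_def)
qed

end


section \<open>Counting restarts\<close>

text \<open>All that matters for the count of iterations: at least \<open>L\<close> iterations without restart
  reduce \<open>N\<close> at least by the factor \<open>e\<close>, from any starting point.\<close>

locale restart_scheme =
  fixes T :: "'v::real_vector \<Rightarrow> 'v" and N :: "'v \<Rightarrow> real" and L :: nat
  assumes nonneg: "\<And>y. 0 \<le> N y"
    and cycle: "\<And>r m. L \<le> m \<Longrightarrow> N (fista_y T r m) \<le> N r / exp 1"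
    and L_pos: "1 \<le> L"
begin

text \<open>After \<open>k\<close> iterations the algorithm is \<open>m < L\<close> iterations away from its last restart point
  \<open>r\<close>, and each of the completed cycles took at most \<open>L\<close> iterations.\<close>

lemma gbr_invariant:
  obtains r m where "carried (gbr T N r0 k) = fista T r m" "rho (gbr T N r0 k) = N r"
    "N r \<le> (1 / exp 1) ^ restarts (gbr T N r0 k) * N r0"
    "r = r0 \<or> (\<exists>i\<le>k. r = gbr_y T N r0 i)"
    "k \<le> L * restarts (gbr T N r0 k) + m" "m < L"
proof -
  have "\<exists>r m. carried (gbr T N r0 k) = fista T r m \<and> rho (gbr T N r0 k) = N r \<and>
    N r \<le> (1 / exp 1) ^ restarts (gbr T N r0 k) * N r0 \<and>
    (r = r0 \<or> (\<exists>i\<le>k. r = gbr_y T N r0 i)) \<and>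
    k \<le> L * restarts (gbr T N r0 k) + m \<and> m < L"
  proof (induction k)
    case 0
    show ?case using L_pos by (intro exI[of _ r0] exI[of _ 0]) auto
  next
    case (Suc k)
    define s where "s = gbr T N r0 k"
    obtain r m where IH: "carried s = fista T r m" "rho s = N r"
      "N r \<le> (1 / exp 1) ^ restarts s * N r0"
      "r = r0 \<or> (\<exists>i\<le>k. r = gbr_y T N r0 i)"
      "k \<le> L * restarts s + m" "m < L"
      using Suc.IH unfolding s_def by blast
    define y where "y = fista_y T r (Suc m)"
    have step: "gbr T N r0 (Suc k) = (if N y \<le> N r / exp 1
      then \<lparr>y_computed = y, carried = (T y, T y, 1), restarts = restarts s + 1, rho = N y\<rparr>
      else \<lparr>y_computed = y, carried = fista T r (Suc m), restarts = restarts s, rho = N r\<rparr>)"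
      using IH(1,2) by (simp add: gbr_step_def Let_def y_def fista_y_def flip: s_def)
    show ?case
    proof (cases "N y \<le> N r / exp 1")
      case True
      have "N y \<le> 1 / exp 1 * ((1 / exp 1) ^ restarts s * N r0)"
        using True mult_left_mono[OF IH(3), of "1 / exp 1"] by simp
      moreover have "y = gbr_y T N r0 (Suc k)"
        using step True by (simp add: gbr_y_def)
      ultimately show ?thesis
        unfolding step using True IH(5,6)
        by (intro exI[of _ y] exI[of _ 0]) (auto simp: mult.assoc)
    next
      case False
      then have "Suc m < L"
        using cycle[of "Suc m" r] unfolding y_def by (meson not_less)
      then show ?thesis
        unfolding step using False IH
        by (intro exI[of _ r] exI[of _ "Suc m"]) (auto intro: le_SucI)
    qed
  qed
  then show thesis using that by blast
qed

lemma gbr_best_gradient: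
  assumes a: "real L \<le> a"
  shows "Min ((\<lambda>i. N (gbr_y T N r0 i)) ` {0..k} \<union> {N r0})
    \<le> exp 1 * (1 / exp 1) powi \<lfloor>real k / a\<rfloor> * N r0"
proof -
  define j where "j = restarts (gbr T N r0 k)"
  obtain r m where inv: "N r \<le> (1 / exp 1) ^ j * N r0"
    "r = r0 \<or> (\<exists>i\<le>k. r = gbr_y T N r0 i)" "k \<le> L * j + m" "m < L"
    unfolding j_def using gbr_invariant[of r0 k] by metis
  define q where "q = nat \<lfloor>real k / a\<rfloor>"
  have a_pos: "0 < a" using L_pos a by linarith
  have "k < L * (j + 1)" using inv(3,4) by simp
  then have "real k < real L * real (j + 1)"
    by (metis of_nat_less_iff of_nat_mult)
  also have "\<dots> \<le> a * real (j + 1)" using a by (intro mult_right_mono) auto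
  finally have "real k / a < real (j + 1)"
    using a_pos by (simp add: field_simps)
  then have "\<lfloor>real k / a\<rfloor> < int (j + 1)" by (simp add: floor_less_iff)
  then have "q \<le> j" by (simp add: q_def)
  have powi: "(1 / exp 1) powi \<lfloor>real k / a\<rfloor> = (1 / exp 1 :: real) ^ q"
    using a_pos by (simp add: q_def power_int_def)
  have "Min ((\<lambda>i. N (gbr_y T N r0 i)) ` {0..k} \<union> {N r0}) \<le> N r"
    using inv(2) by (intro Min_le) auto
  also have "\<dots> \<le> (1 / exp 1) ^ j * N r0" by (fact inv(1))
  also have "\<dots> \<le> (1 / exp 1) ^ q * N r0"
    using \<open>q \<le> j\<close> nonneg by (intro mult_right_mono power_decreasing) auto
  also have "\<dots> \<le> exp 1 * ((1 / exp 1) ^ q * N r0)"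
    using nonneg[of r0] mult_right_mono[of 1 "exp 1" "(1 / exp 1) ^ q * N r0"] by simp
  finally show ?thesis by (simp add: powi mult.assoc)
qed

text \<open>Here \<open>J\<close> is a number of restarts that forces \<open>\<rho> \<le> \<epsilon>\<close>.\<close>

lemma gbr_exit_bound:
  assumes J: "1 \<le> J" "(1 / exp 1) ^ J * N r0 \<le> \<epsilon>"
  obtains k where "gbr_exit T N r0 \<epsilon> k" "k \<le> L * J"
proof -
  define j where "j = restarts (gbr T N r0 (L * J))"
  obtain r m where inv: "rho (gbr T N r0 (L * J)) = N r" "N r \<le> (1 / exp 1) ^ j * N r0"
    "L * J \<le> L * j + m" "m < L"
    unfolding j_def using gbr_invariant[of r0 "L * J"] by metis
  have "L * J < L * (j + 1)" using inv(3,4) by simp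
  then have "J < j + 1" by (simp only: mult_less_cancel1)
  then have "J \<le> j" by simp
  then have "(1 / exp 1) ^ j * N r0 \<le> (1 / exp 1) ^ J * N r0"
    using nonneg by (intro mult_right_mono power_decreasing) auto
  then have P: "1 \<le> L * J \<and> rho (gbr T N r0 (L * J)) \<le> \<epsilon>"
    using inv J L_pos by simp
  define k where "k = (LEAST k. 1 \<le> k \<and> rho (gbr T N r0 k) \<le> \<epsilon>)"
  have "1 \<le> k \<and> rho (gbr T N r0 k) \<le> \<epsilon>" "k \<le> L * J"
    unfolding k_def using LeastI[of "\<lambda>k. 1 \<le> k \<and> rho (gbr T N r0 k) \<le> \<epsilon>", OF P]
    using Least_le[of "\<lambda>k. 1 \<le> k \<and> rho (gbr T N r0 k) \<le> \<epsilon>", OF P] by blast+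
  moreover have "\<not> rho (gbr T N r0 i) \<le> \<epsilon>" if "1 \<le> i" "i < k" for i
    using not_less_Least[of i "\<lambda>k. 1 \<le> k \<and> rho (gbr T N r0 k) \<le> \<epsilon>"] that by (auto simp: k_def)
  ultimately show thesis
    by (intro that[of k]) (auto simp: gbr_exit_def gbr_performed_def)
qed

end


section \<open>The convergence rates\<close>

theorem theorem3p20:
  fixes \<Psi> :: "real^'n \<Rightarrow> ereal"
    and h :: "real^'n \<Rightarrow> real"
    and dh :: "real^'n \<Rightarrow> real^'n"
    and Z :: "(real^'n) set"
    and R :: "real^'n^'n"
    and \<mu> \<epsilon> a :: real
    and r0 :: "real^'n"
    and f :: "real^'n \<Rightarrow> ereal"
    and T :: "real^'n \<Rightarrow> real^'n"
    and N :: "real^'n \<Rightarrow> real"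
  assumes f_def: "f = objective \<Psi> h"
    and A1: "proper_fun \<Psi>" "closed_fun \<Psi>" "convex_fun \<Psi>"
    and A2: "\<And>y. GDERIV h y :> dh y" "convex_on UNIV h" "sym_pos_def R"
            "\<And>z y. h z \<le> h y + dh y \<bullet> (z - y) + 1 / 2 * (wnorm R (z - y))\<^sup>2"
    and A3: "Z \<noteq> {}" "closed Z" "convex Z"
    and A4: "\<exists>zs \<in> Z \<inter> edom \<Psi>. f zs = opt_value f Z"
    and growth: "\<mu> > 0" "quadratic_growth \<mu> R f Z"
    and T_def: "T = comp_step \<Psi> dh Z R"
    and N_def: "N = (\<lambda>y. wnorm (matrix_inv R) (comp_grad \<Psi> dh Z R y))"
    and eps: "\<epsilon> > 0"
    and a_def: "a = max 1 (4 * exp 1 * (1 + sqrt (\<mu> + 1)) / \<mu>)"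
  shows
    "(\<forall>k\<ge>1. N (fista_y T r0 k) \<le> 4 * (1 + sqrt (\<mu> + 1)) / (\<mu> * real k) * N r0)
   \<and> (\<forall>k. real k \<ge> 4 * exp 1 / \<mu> * (1 + sqrt (\<mu> + 1)) \<longrightarrow>
          N (fista_y T r0 k) \<le> 1 / exp 1 * N r0)
   \<and> (\<forall>k. gbr_performed T N r0 \<epsilon> k \<longrightarrow>
          Min ((\<lambda>i. N (gbr_y T N r0 i)) ` {0..k} \<union> {N r0})
            \<le> exp 1 * (1 / exp 1) powi \<lfloor>real k / a\<rfloor> * N r0)
   \<and> (\<exists>k_out. gbr_exit T N r0 \<epsilon> k_out \<and>
          (N r0 > \<epsilon> \<longrightarrow>
             real k_out \<le> max 1 (4 * exp 1 * (1 + sqrt (\<mu> + 1)) / \<mu>)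
                            * of_int \<lceil>ln (N r0 / \<epsilon>)\<rceil>))"
proof -
  interpret composite_problem \<Psi> h dh Z R
    using A1 A2 A3 A4 by unfold_locales (auto simp: f_def)
  define A where "A = 4 * exp 1 * (1 + sqrt (\<mu> + 1)) / \<mu>"
  have N_eq: "N y = wnorm R (y - T y)" for y
    by (simp add: N_def T_def wnorm_comp_grad)
  have N_nonneg: "0 \<le> N y" for y by (simp add: N_eq wnorm_nonneg[OF R])
  have rate: "(real k + 2) * N (fista_y T r k) \<le> A / exp 1 * N r" for r k
  proof -
    obtain s where s: "s \<in> D" "F s = Fopt"
      "wnorm R (T r - s) \<le> (1 + sqrt (\<mu> + 1)) / \<mu> * wnorm R (r - T r)"
      using optimal_point_near_gradient_step[of \<mu> r] growth f_def T_def by blast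
    have "(real k + 2) * N (fista_y T r k) \<le> 4 * wnorm R (T r - s)"
      using fista_gradient_bound[OF s(1,2), of k r] by (simp add: N_eq T_def)
    also have "\<dots> \<le> 4 * ((1 + sqrt (\<mu> + 1)) / \<mu> * N r)"
      using s(3) by (intro mult_left_mono) (simp_all add: N_eq T_def)
    also have "\<dots> = A / exp 1 * N r" by (simp add: A_def)
    finally show ?thesis .
  qed
  have i: "N (fista_y T r0 k) \<le> 4 * (1 + sqrt (\<mu> + 1)) / (\<mu> * real k) * N r0" if "1 \<le> k" for k
  proof -
    have "real k * N (fista_y T r0 k) \<le> (real k + 2) * N (fista_y T r0 k)"
      using N_nonneg by (intro mult_right_mono) auto
    also have "\<dots> \<le> A / exp 1 * N r0" by (rule rate)
    also have "\<dots> = 4 * (1 + sqrt (\<mu> + 1)) / \<mu> * N r0" by (simp add: A_def)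
    finally show ?thesis
      using that growth(1) by (simp add: field_simps)
  qed
  have decrease: "N (fista_y T r k) \<le> N r / exp 1" if "A \<le> real k + 2" for r k
  proof -
    have "(real k + 2) * N (fista_y T r k) \<le> A / exp 1 * N r" by (rule rate)
    also have "\<dots> \<le> (real k + 2) / exp 1 * N r"
      using that N_nonneg by (intro mult_right_mono divide_right_mono) auto
    also have "\<dots> = (real k + 2) * (N r / exp 1)" by simp
    finally show ?thesis by (subst (asm) mult_le_cancel_left_pos) auto
  qed
  have ii: "N (fista_y T r0 k) \<le> 1 / exp 1 * N r0"
    if "4 * exp 1 / \<mu> * (1 + sqrt (\<mu> + 1)) \<le> real k" for k
    using decrease[of k r0] that by (simp add: A_def)
  define L where "L = nat \<lfloor>a\<rfloor>"
  have a: "a = max 1 A" by (simp add: a_def A_def)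
  have L: "1 \<le> L" "real L \<le> a" "a < real L + 1"
    unfolding L_def using a by linarith+
  interpret restart_scheme T N L
  proof
    \<comment> \<open>\<open>A \<le> a < \<lfloor>a\<rfloor> + 1 \<le> m + 2\<close>\<close>
    show "N (fista_y T r m) \<le> N r / exp 1" if "L \<le> m" for r m
      using that L a by (intro decrease) linarith
  qed (use N_nonneg L in auto)
  have iii: "Min ((\<lambda>i. N (gbr_y T N r0 i)) ` {0..k} \<union> {N r0})
      \<le> exp 1 * (1 / exp 1) powi \<lfloor>real k / a\<rfloor> * N r0" for k
    by (rule gbr_best_gradient[OF L(2)])
  have iv: "\<exists>k_out. gbr_exit T N r0 \<epsilon> k_out \<and>
      (N r0 > \<epsilon> \<longrightarrow> real k_out \<le> a * of_int \<lceil>ln (N r0 / \<epsilon>)\<rceil>)"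
  proof -
    have target: "(1 / exp 1) ^ J * N r0 \<le> \<epsilon>" if "N r0 \<le> \<epsilon> \<or> ln (N r0 / \<epsilon>) \<le> real J" for J
    proof (cases "N r0 \<le> \<epsilon>")
      case True
      have "(1 / exp 1 :: real) ^ J * N r0 \<le> 1 * N r0"
        using N_nonneg by (intro mult_right_mono power_le_one) auto
      then show ?thesis using True by simp
    next
      case False
      then have "N r0 / \<epsilon> = exp (ln (N r0 / \<epsilon>))" using eps by simp
      also have "\<dots> \<le> exp (real J)" using that False by simp
      also have "\<dots> = exp 1 ^ J" by (simp flip: exp_of_nat_mult)
      finally show ?thesis using eps by (simp add: power_one_over field_simps)
    qed
    show ?thesis
    proof (cases "N r0 \<le> \<epsilon>")
      case True
      then show ?thesis
        using gbr_exit_bound[OF order_refl target] by (metis not_less)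
    next
      case False
      define J where "J = nat \<lceil>ln (N r0 / \<epsilon>)\<rceil>"
      have "0 < ln (N r0 / \<epsilon>)" using False eps by (intro ln_gt_zero) simp
      then have J: "1 \<le> J" "of_int \<lceil>ln (N r0 / \<epsilon>)\<rceil> = real J" "ln (N r0 / \<epsilon>) \<le> real J"
        unfolding J_def by linarith+
      obtain k where k: "gbr_exit T N r0 \<epsilon> k" "k \<le> L * J"
        using gbr_exit_bound[OF J(1) target] J(3) by blast
      have "real k \<le> real L * real J" using k(2) by (metis of_nat_le_iff of_nat_mult)
      also have "\<dots> \<le> a * real J" using L by (intro mult_right_mono) auto
      finally show ?thesis using k(1) J(2) by auto
    qed
  qed
  show ?thesis
    using i ii iii iv unfolding a_def by blast
qed

end
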